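(* For $b>0$ let $\mathcal{P}^{w.e.}_b(\zeta,t)$ be the limiting joint density at the weakly non-normal edge with parameter $b$ (given in the context). Then for every $\delta\in\mathbb{R}$ and $\sigma>0$, $$\lim_{b\to\infty}2b^4\,\mathcal{P}^{w.e.}_b\left(\sqrt2\,b\,\delta,\sqrt2\,b^3\sigma\right)=\frac{1}{4\pi\sigma^2}e^{\frac\delta\sigma-\frac{1}{4\sigma^2}}\left(e^{-2\delta^2}+\left(\frac1\sigma-2\delta\right)\int_{2\delta}^\infty e^{-\frac{p^2}{2}}dp\right).$$
   Context: Deformed Airy function: $\mathrm{Ai}_b(\zeta)=e^{\frac{b^2\zeta}{2}+\frac{b^6}{12}}\mathrm{Ai}\left(\zeta+\frac{b^4}{4}\right)$, where $\mathrm{Ai}$ is the Airy function. The function $\mathcal{P}^{w.e.}_b$, for $\zeta\in\mathbb{R}$ and $t>0$, is $$\mathcal{P}^{w.e.}_b(\zeta,t)=\frac{b^2}{t^2}\left[T_0(\zeta)+\frac{b^2T_1(\zeta)}{t}+\frac{b^4T_2(\zeta)}{t^2}+\frac{b^6T_3(\zeta)}{t^3}\right]\exp\left(\frac{b^2\zeta}{t}-\frac{b^6}{2t^2}-\frac{b^6}{3t^3}\right),$$ with (all depending on $b$) $$T_3(\zeta)=\int_\zeta^\infty\left[\mathrm{Ai}_b'(p)^2-\mathrm{Ai}_b(p)\mathrm{Ai}_b''(p)\right]dp,$$ $$T_2(\zeta)=b^2T_3(\zeta)+\int_\zeta^\infty\mathrm{Ai}_b(p)^2dp,$$ $$T_1(\zeta)=-\zeta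 T_3(\zeta)+\tfrac12\mathrm{Ai}_b(\zeta)^2+b^2\int_\zeta^\infty\mathrm{Ai}_b(p)^2dp,$$ $$T_0(\zeta)=-T_3(\zeta)+\tfrac12b^2\mathrm{Ai}_b(\zeta)^2-\tfrac12\mathrm{Ai}_b(\zeta)\mathrm{Ai}_b'(\zeta)-\zeta\int_\zeta^\infty\mathrm{Ai}_b(p)^2dp.$$ (It arises as the scaling limit, at the spectral edge and with $(1-\tau)N^{1/3}=b^2$, of the joint density of a real eigenvalue and its squared condition number minus one in the real elliptic Gaussian ensemble; the explicit formula above is taken as its definition here.) *)

theory Defs
  imports "HOL-Analysis.Analysis"
begin

(* The defining integral converges only conditionally. It is therefore taken in the
   Henstock-Kurzweil sense, which over a half-line agrees with the improper Riemann
   integral; the Lebesgue/Bochner integral of this function does not exist. *)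
definition airy_Ai :: "real \<Rightarrow> real" where
  "airy_Ai x = 1 / pi * integral {0..} (\<lambda>s. cos (s ^ 3 / 3 + x * s))"

definition deformed_Ai :: "real \<Rightarrow> real \<Rightarrow> real" where
  "deformed_Ai b \<zeta> = exp (b\<^sup>2 * \<zeta> / 2 + b ^ 6 / 12) * airy_Ai (\<zeta> + b ^ 4 / 4)"

definition T3 :: "real \<Rightarrow> real \<Rightarrow> real" where
  "T3 b \<zeta> = integral {\<zeta>..}
     (\<lambda>p. (deriv (deformed_Ai b) p)\<^sup>2 - deformed_Ai b p * deriv (deriv (deformed_Ai b)) p)"

definition T2 :: "real \<Rightarrow> real \<Rightarrow> real" where
  "T2 b \<zeta> = b\<^sup>2 * T3 b \<zeta> + integral {\<zeta>..} (\<lambda>p. (deformed_Ai b p)\<^sup>2)"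

definition T1 :: "real \<Rightarrow> real \<Rightarrow> real" where
  "T1 b \<zeta> = - \<zeta> * T3 b \<zeta> + 1 / 2 * (deformed_Ai b \<zeta>)\<^sup>2
     + b\<^sup>2 * integral {\<zeta>..} (\<lambda>p. (deformed_Ai b p)\<^sup>2)"

definition T0 :: "real \<Rightarrow> real \<Rightarrow> real" where
  "T0 b \<zeta> = - T3 b \<zeta> + 1 / 2 * b\<^sup>2 * (deformed_Ai b \<zeta>)\<^sup>2
     - 1 / 2 * deformed_Ai b \<zeta> * deriv (deformed_Ai b) \<zeta>
     - \<zeta> * integral {\<zeta>..} (\<lambda>p. (deformed_Ai b p)\<^sup>2)"

(* The joint density at the weakly non-normal edge; only the values at b > 0 and t > 0
   are meaningful. *)
definition P_we :: "real \<Rightarrow> real \<Rightarrow> real \<Rightarrow> real" where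
  "P_we b \<zeta> t =
     b\<^sup>2 / t\<^sup>2
     * (T0 b \<zeta> + b\<^sup>2 * T1 b \<zeta> / t + b ^ 4 * T2 b \<zeta> / t\<^sup>2 + b ^ 6 * T3 b \<zeta> / t ^ 3)
     * exp (b\<^sup>2 * \<zeta> / t - b ^ 6 / (2 * t\<^sup>2) - b ^ 6 / (3 * t ^ 3))"

end

theory Submission
  imports Defs "HOL-Complex_Analysis.Complex_Analysis" "HOL-Probability.Characteristic_Functions"
    "HOL-Real_Asymp.Real_Asymp"
begin

text \<open>
  Moving the contour of the Airy integral to \<open>Im z = a\<close> turns it into an absolutely convergent
  integral with Gaussian factor \<open>exp (- a s\<^sup>2)\<close>. With \<open>a = b\<^sup>2 / 2 + c / b\<close> and \<open>s = u / b\<close> the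
  exponential prefactor of the deformed Airy function cancels, and \<open>b * deformed_Ai b (b q)\<close> depends
  on \<open>b\<close> only through \<open>\<epsilon> = 1 / b ^ 3\<close>; its value does not depend on \<open>c \<ge> 0\<close>. Taking \<open>c = 0\<close> gives
  the pointwise limit \<open>exp (- q\<^sup>2 / 2) / sqrt (2 pi)\<close>, and \<open>c = 1\<close> gives bounds
  \<open>D * exp (- q)\<close> uniform in \<open>\<epsilon> \<le> 1\<close> for the function and its first two derivatives. Dominated
  convergence handles the integral of the square, and \<open>T3\<close> is of order \<open>1 / b ^ 3\<close>.
\<close>

section \<open>Integrals over half-lines as improper integrals\<close>

text \<open>The gauge integral over an unbounded set is a limit over large boxes
  \<open>{a..b}\<close>. Such a box meets the half-line in \<open>{max c a..b}\<close>, so once it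
  reaches below \<open>c\<close> only its right end matters. This form suits the Airy integral,
  which converges only conditionally.\<close>

lemma has_integral_atLeast_iff_tendsto:
  fixes f :: "real \<Rightarrow> real"
  shows "(f has_integral I) {c..} \<longleftrightarrow>
    (\<forall>R. f integrable_on {c..R}) \<and> ((\<lambda>R. integral {c..R} f) \<longlongrightarrow> I) at_top"
proof -
  have inter: "{c..} \<inter> {a..b} = {max c a..b}" for a b :: real
    by auto
  have ball: "ball 0 B \<subseteq> {a..b} \<longleftrightarrow> a \<le> - B \<and> B \<le> b" if "B > 0" for a b B :: real
    using that by (simp add: ball_eq_greaterThanLessThan greaterThanLessThan_subseteq_atLeastAtMost_iff)
  have "(f has_integral I) {c..} \<longleftrightarrow> (\<forall>a b. f integrable_on {max c a..b}) \<and>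
      (\<forall>e>0. \<exists>B>0. \<forall>a b. ball 0 B \<subseteq> {a..b} \<longrightarrow> norm (integral {max c a..b} f - I) < e)"
    unfolding has_integral_alt'[of f I "{c..}"] integral_restrict_Int integrable_restrict_Int
      cbox_interval inter ..
  also have "(\<forall>a b. f integrable_on {max c a..b}) \<longleftrightarrow> (\<forall>R. f integrable_on {c..R})"
  proof safe
    fix R assume "\<forall>a b. f integrable_on {max c a..b}"
    then have "f integrable_on {max c c..R}" by blast
    then show "f integrable_on {c..R}" by simp
  next
    fix a b assume "\<forall>R. f integrable_on {c..R}"
    then show "f integrable_on {max c a..b}"
      by - (rule integrable_on_subinterval[of f "{c..b}"], auto)
  qed
  also have "(\<forall>e>0. \<exists>B>0. \<forall>a b. ball 0 B \<subseteq> {a..b} \<longrightarrow> norm (integral {max c a..b} f - I) < e)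
      \<longleftrightarrow> ((\<lambda>R. integral {c..R} f) \<longlongrightarrow> I) at_top"
  proof
    assume L: "\<forall>e>0. \<exists>B>0. \<forall>a b. ball 0 B \<subseteq> {a..b} \<longrightarrow> norm (integral {max c a..b} f - I) < e"
    show "((\<lambda>R. integral {c..R} f) \<longlongrightarrow> I) at_top"
    proof (rule tendstoI)
      fix e :: real assume "e > 0"
      then obtain B where B: "B > 0"
        "\<And>a b. ball 0 B \<subseteq> {a..b} \<Longrightarrow> norm (integral {max c a..b} f - I) < e"
        using L by meson
      have "dist (integral {c..R} f) I < e" if "R \<ge> B" for R
        \<comment> \<open>The left end \<open>min c (- B)\<close> makes the box contain the ball
          while \<open>max c a\<close> is just \<open>c\<close>.\<close>
        using B(2)[of "min c (- B)" R] that B(1) by (simp add: ball dist_real_def max_absorb1)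
      then show "\<forall>\<^sub>F R in at_top. dist (integral {c..R} f) I < e"
        by (auto simp: eventually_at_top_linorder)
    qed
  next
    assume R: "((\<lambda>R. integral {c..R} f) \<longlongrightarrow> I) at_top"
    show "\<forall>e>0. \<exists>B>0. \<forall>a b. ball 0 B \<subseteq> {a..b} \<longrightarrow> norm (integral {max c a..b} f - I) < e"
    proof (intro allI impI)
      fix e :: real assume "e > 0"
      then obtain R0 where R0: "\<And>R. R \<ge> R0 \<Longrightarrow> dist (integral {c..R} f) I < e"
        using tendstoD[OF R] by (auto simp: eventually_at_top_linorder)
      define B where "B = max 1 (max \<bar>c\<bar> R0)"
      have "norm (integral {max c a..b} f - I) < e" if "ball 0 B \<subseteq> {a..b}" for a b
      proof -
        have "a \<le> - B" "B \<le> b" using that by (auto simp: ball B_def)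
        then have "max c a = c" "R0 \<le> b" by (auto simp: B_def)
        then show ?thesis using R0[of b] by (simp add: dist_real_def)
      qed
      then show "\<exists>B>0. \<forall>a b. ball 0 B \<subseteq> {a..b} \<longrightarrow> norm (integral {max c a..b} f - I) < e"
        by (intro exI[of _ B]) (auto simp: B_def)
    qed
  qed
  finally show ?thesis .
qed

lemma has_integral_atLeast_scale:
  fixes f :: "real \<Rightarrow> real"
  assumes "m > 0" and "(f has_integral I) {m * c..}"
  shows "((\<lambda>x. f (m * x)) has_integral I / m) {c..}"
proof -
  have f: "\<And>R. f integrable_on {m * c..R}" "((\<lambda>R. integral {m * c..R} f) \<longlongrightarrow> I) at_top"
    using assms(2) by (auto simp: has_integral_atLeast_iff_tendsto)
  have im: "(\<lambda>x. x / m) ` {m * c..m * R} = {c..R}" for R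
    using assms(1) by (subst image_divide_atLeastAtMost) auto
  have 1: "((\<lambda>x. f (m * x)) has_integral integral {m * c..m * R} f / m) {c..R}" for R
    using has_integral_stretch_real[OF integrable_integral[OF f(1)], of m "m * R"] assms(1)
    by (simp add: im)
  have "filterlim (\<lambda>R. m * R) at_top at_top"
    by (rule filterlim_tendsto_pos_mult_at_top[OF tendsto_const assms(1) filterlim_ident])
  from tendsto_divide[OF filterlim_compose[OF f(2) this] tendsto_const[of m]]
  have "((\<lambda>R. integral {c..R} (\<lambda>x. f (m * x))) \<longlongrightarrow> I / m) at_top"
    using assms(1) integral_unique[OF 1] by simp
  then show ?thesis using 1 by (auto simp: has_integral_atLeast_iff_tendsto integrable_on_def)
qed

lemma integral_atLeast_scale:
  fixes f :: "real \<Rightarrow> real"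
  assumes m: "m > 0"
  shows "integral {c..} (\<lambda>x. f (m * x)) = integral {m * c..} f / m"
proof (cases "f integrable_on {m * c..}")
  case True
  then show ?thesis
    using has_integral_atLeast_scale[OF m integrable_integral] by (simp add: integral_unique)
next
  case False
  \<comment> \<open>Scaling back by \<open>1 / m\<close> would carry integrability over to
    \<open>f\<close>. So neither side is integrable, both integrals take the default value 0, and
    the identity persists.\<close>
  have "\<not> (\<lambda>x. f (m * x)) integrable_on {c..}"
  proof
    assume "(\<lambda>x. f (m * x)) integrable_on {c..}"
    then obtain J where "((\<lambda>x. f (m * x)) has_integral J) {1 / m * (m * c)..}"
      using m by (auto simp: integrable_on_def)
    from has_integral_atLeast_scale[OF _ this] m show False
      using False by (auto simp: integrable_on_def)
  qed
  with False show ?thesis by (simp add: not_integrable_integral)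
qed

section \<open>Oscillatory integrals with Gaussian damping\<close>

lemma integrable_power_mult_gaussian:
  assumes "\<mu> > 0"
  shows "(\<lambda>u::real. u ^ k * exp (- \<mu> * u\<^sup>2)) absolutely_integrable_on UNIV"
proof -
  \<comment> \<open>The standard deviation for which the centred normal density is
    \<open>exp (- \<mu> * u\<^sup>2)\<close> up to normalisation; the integrand is then a normal
    moment.\<close>
  define s where "s = sqrt (1 / (2 * \<mu>))"
  have s: "s > 0" "2 * s\<^sup>2 = 1 / \<mu>" using assms by (auto simp: s_def)
  have "integrable lborel (\<lambda>x. (normal_density 0 s x * (x - 0) ^ k) * sqrt (2 * pi * s\<^sup>2))"
    by (intro integrable_mult_left integrable_normal_moment s)
  also have "(\<lambda>x. (normal_density 0 s x * (x - 0) ^ k) * sqrt (2 * pi * s\<^sup>2))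
      = (\<lambda>u. u ^ k * exp (- \<mu> * u\<^sup>2))"
    using s assms by (auto simp: normal_density_def real_sqrt_mult field_simps)
  finally have "set_integrable lborel UNIV (\<lambda>u::real. u ^ k * exp (- \<mu> * u\<^sup>2))"
    by (simp add: set_integrable_def)
  then show ?thesis
    by (simp add: absolutely_integrable_on_def set_borel_integral_eq_integral(1)
      set_integrable_def integrable_completion)
qed

text \<open>Airy-type integrals on a shifted contour. The power \<open>k\<close> and the phase
  \<theta> make the family closed under differentiation in \<open>y\<close>, which raises
  \<open>k\<close> by one and advances \<theta> by \<open>pi / 2\<close>.\<close>

definition osc_int :: "nat \<Rightarrow> real \<Rightarrow> real \<Rightarrow> real \<Rightarrow> real \<Rightarrow> real" where
  "osc_int k \<mu> \<epsilon> \<theta> y =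
     integral {0..} (\<lambda>u. u ^ k * exp (- \<mu> * u\<^sup>2) * cos (\<epsilon> * u ^ 3 / 3 + y * u + \<theta>))"

lemma integrable_gaussian_bounded:
  fixes h :: "real \<Rightarrow> real"
  assumes "\<mu> > 0" and "continuous_on UNIV h" and "\<And>u. \<bar>h u\<bar> \<le> C"
  shows "(\<lambda>u. u ^ k * exp (- \<mu> * u\<^sup>2) * h u) absolutely_integrable_on {0..}"
proof (rule measurable_bounded_by_integrable_imp_absolutely_integrable)
  show "(\<lambda>u. u ^ k * exp (- \<mu> * u\<^sup>2) * h u) \<in> borel_measurable (lebesgue_on {0..})"
    by (intro continuous_imp_measurable_on_sets_lebesgue continuous_intros
         continuous_on_subset[OF assms(2)]) auto
  have "(\<lambda>u::real. u ^ k * exp (- \<mu> * u\<^sup>2)) absolutely_integrable_on {0..}"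
    by (rule set_integrable_subset[OF integrable_power_mult_gaussian[OF assms(1)]]) auto
  then have "(\<lambda>u::real. u ^ k * exp (- \<mu> * u\<^sup>2)) integrable_on {0..}"
    by (rule set_lebesgue_integral_eq_integral(1))
  from integrable_on_cmult_left[OF this, of C]
  show "(\<lambda>u. C * (u ^ k * exp (- \<mu> * u\<^sup>2))) integrable_on {0..}"
    by simp
  show "norm (x ^ k * exp (- \<mu> * x\<^sup>2) * h x) \<le> C * (x ^ k * exp (- \<mu> * x\<^sup>2))" if "x \<in> {0..}" for x
    using that mult_right_mono[OF assms(3)[of x], of "x ^ k * exp (- \<mu> * x\<^sup>2)"]
    by (simp add: abs_mult mult_ac)
qed auto

lemma osc_int_integrable:
  fixes \<mu> \<epsilon> \<theta> y :: real
  assumes "\<mu> > 0"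
  shows "(\<lambda>u. u ^ k * exp (- \<mu> * u\<^sup>2) * cos (\<epsilon> * u ^ 3 / 3 + y * u + \<theta>)) integrable_on {0..}"
  by (rule set_lebesgue_integral_eq_integral(1), rule integrable_gaussian_bounded[where C = 1])
    (use assms in \<open>auto intro!: continuous_intros\<close>)

lemma osc_int_has_integral:
  fixes \<mu> \<epsilon> \<theta> y :: real
  assumes "\<mu> > 0"
  shows "((\<lambda>u. u ^ k * exp (- \<mu> * u\<^sup>2) * cos (\<epsilon> * u ^ 3 / 3 + y * u + \<theta>))
    has_integral osc_int k \<mu> \<epsilon> \<theta> y) {0..}"
  unfolding osc_int_def by (rule integrable_integral[OF osc_int_integrable[OF assms]])

lemma power_mult_gaussian_integrable:
  assumes "\<mu> > 0"
  shows "(\<lambda>u::real. u ^ k * exp (- \<mu> * u\<^sup>2)) integrable_on {0..}"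
  using osc_int_integrable[OF assms, of k 0 0 0] by simp

text \<open>Bounding the cosine by 1 leaves a Gaussian moment, which decreases in the damping rate.
  The right-hand side is that pure moment, so the bound is uniform in \<epsilon>, \<theta> and
  \<open>y\<close>.\<close>

lemma abs_osc_int_le:
  assumes "\<mu> \<ge> \<nu>" and "\<nu> > 0"
  shows "\<bar>osc_int k \<mu> \<epsilon> \<theta> y\<bar> \<le> osc_int k \<nu> 0 0 0"
proof -
  have "\<bar>u ^ k * exp (- \<mu> * u\<^sup>2) * cos (\<epsilon> * u ^ 3 / 3 + y * u + \<theta>)\<bar>
      \<le> u ^ k * exp (- \<nu> * u\<^sup>2)" if "u \<ge> 0" for u
  proof -
    have "\<bar>u ^ k * exp (- \<mu> * u\<^sup>2) * cos (\<epsilon> * u ^ 3 / 3 + y * u + \<theta>)\<bar>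
        \<le> u ^ k * exp (- \<mu> * u\<^sup>2) * 1"
      unfolding abs_mult using that by (intro mult_mono abs_cos_le_one) auto
    also have "\<dots> \<le> u ^ k * exp (- \<nu> * u\<^sup>2)"
      using that assms by (auto intro!: mult_left_mono mult_right_mono)
    finally show ?thesis .
  qed
  then show ?thesis
    unfolding osc_int_def real_norm_def[symmetric]
    using assms
    by (intro integral_norm_bound_integral osc_int_integrable) auto
qed

text \<open>The first-order Taylor remainder of the exponential on the imaginary axis is rotated by
  \<open>cis A\<close>, which keeps its modulus; the real part is the expression here.\<close>

lemma abs_cos_add_sub_le: "\<bar>cos (A + x) - cos A + x * sin A\<bar> \<le> x\<^sup>2" for A x :: real
proof -
  have "cmod (cis A * (iexp x - (\<Sum>k\<le>1. (\<i> * x) ^ k / fact k))) \<le> \<bar>x\<bar> ^ 2 / fact 2"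
    unfolding norm_mult using iexp_approx1[of x 1] by (simp add: numeral_2_eq_2)
  also have "\<dots> \<le> x\<^sup>2" by simp
  finally have "cmod (cis A * (iexp x - (\<Sum>k\<le>1. (\<i> * x) ^ k / fact k))) \<le> x\<^sup>2" .
  moreover have "Re (cis A * (iexp x - (\<Sum>k\<le>1. (\<i> * x) ^ k / fact k)))
      = cos (A + x) - cos A + x * sin A"
  proof -
    have "(\<Sum>k\<le>1. (\<i> * x) ^ k / fact k) = 1 + \<i> * x" by simp
    moreover have "iexp x = cis x" by (simp add: cis_conv_exp)
    ultimately show ?thesis by (simp only:) (simp add: cos_add algebra_simps)
  qed
  ultimately show ?thesis by (metis (no_types) abs_Re_le_cmod order_trans)
qed

text \<open>A remainder quadratic in \<open>h\<close> leaves an error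
  \<open>C * \<bar>h\<bar>\<close> in the difference quotient. Pointwise bounds of this kind survive
  integration, which gives differentiation under the integral sign below.\<close>

lemma DERIV_quadratic_bound:
  fixes f :: "real \<Rightarrow> real"
  assumes "\<And>h. \<bar>f (x + h) - f x - h * D\<bar> \<le> C * h\<^sup>2"
  shows "(f has_real_derivative D) (at x)"
  unfolding DERIV_def
proof (rule LIM_zero_cancel[OF Lim_transform_bound[where g = "\<lambda>h. C * \<bar>h\<bar>"]])
  show "((\<lambda>h. C * \<bar>h\<bar>) \<longlongrightarrow> 0) (at 0)"
    by (auto intro!: tendsto_eq_intros)
  show "\<forall>\<^sub>F h in at 0. norm ((f (x + h) - f x) / h - D) \<le> norm (C * \<bar>h\<bar>)"
  proof (rule eventually_at_filter[THEN iffD2, OF always_eventually], safe)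
    fix h :: real assume "h \<noteq> 0"
    then have "\<bar>(f (x + h) - f x) / h - D\<bar> = \<bar>f (x + h) - f x - h * D\<bar> / \<bar>h\<bar>"
      by (simp add: field_simps flip: abs_divide)
    also have "\<dots> \<le> C * h\<^sup>2 / \<bar>h\<bar>"
      using assms by (intro divide_right_mono) auto
    also have "\<dots> = C * \<bar>h\<bar>" using \<open>h \<noteq> 0\<close>
      by (simp add: power2_eq_square abs_if)
    also have "\<dots> \<le> norm (C * \<bar>h\<bar>)" by simp
    finally show "norm ((f (x + h) - f x) / h - D) \<le> norm (C * \<bar>h\<bar>)" by simp
  qed
qed

text \<open>The pointwise remainder of the cosine for the increment \<open>h * u\<close> is at most
  \<open>(h * u)\<^sup>2\<close>; integrated, it costs the Gaussian moment of order
  \<open>k + 2\<close>. The phase shift encodes that -sin is the cosine advanced by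
  \<open>pi / 2\<close>.\<close>

lemma osc_int_has_derivative:
  assumes "\<mu> > 0"
  shows "(osc_int k \<mu> \<epsilon> \<theta> has_real_derivative osc_int (Suc k) \<mu> \<epsilon> (\<theta> + pi / 2) y) (at y)"
proof (rule DERIV_quadratic_bound)
  fix h :: real
  let ?A = "\<lambda>u. \<epsilon> * u ^ 3 / 3 + y * u + \<theta>"
  have eq: "u ^ k * exp (- \<mu> * u\<^sup>2) * cos (\<epsilon> * u ^ 3 / 3 + (y + h) * u + \<theta>)
      - u ^ k * exp (- \<mu> * u\<^sup>2) * cos (\<epsilon> * u ^ 3 / 3 + y * u + \<theta>)
      - h * (u ^ Suc k * exp (- \<mu> * u\<^sup>2) * cos (\<epsilon> * u ^ 3 / 3 + y * u + (\<theta> + pi / 2)))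
      = u ^ k * exp (- \<mu> * u\<^sup>2) * (cos (?A u + h * u) - cos (?A u) + h * u * sin (?A u))" for u
  proof -
    have "cos (\<epsilon> * u ^ 3 / 3 + y * u + (\<theta> + pi / 2)) = - sin (?A u)"
      using minus_sin_cos_eq[of "?A u"] by (simp add: add.assoc)
    moreover have "\<epsilon> * u ^ 3 / 3 + (y + h) * u + \<theta> = ?A u + h * u"
      by (simp add: algebra_simps)
    ultimately show ?thesis by (simp add: algebra_simps)
  qed
  have "norm (osc_int k \<mu> \<epsilon> \<theta> (y + h) - osc_int k \<mu> \<epsilon> \<theta> y
      - h * osc_int (Suc k) \<mu> \<epsilon> (\<theta> + pi / 2) y)
      \<le> h\<^sup>2 * integral {0..} (\<lambda>u. u ^ (k + 2) * exp (- \<mu> * u\<^sup>2))"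
  proof -
    let ?F = "\<lambda>u. u ^ k * exp (- \<mu> * u\<^sup>2) * (cos (?A u + h * u) - cos (?A u) + h * u * sin (?A u))"
    let ?G = "\<lambda>u. h\<^sup>2 * (u ^ (k + 2) * exp (- \<mu> * u\<^sup>2))"
    have F: "((\<lambda>u. u ^ k * exp (- \<mu> * u\<^sup>2) * (cos (?A u + h * u) - cos (?A u) + h * u * sin (?A u)))
      has_integral osc_int k \<mu> \<epsilon> \<theta> (y + h) - osc_int k \<mu> \<epsilon> \<theta> y
      - h * osc_int (Suc k) \<mu> \<epsilon> (\<theta> + pi / 2) y) {0..}"
      unfolding eq[symmetric]
      by (intro has_integral_diff has_integral_mult_right osc_int_has_integral assms)
    have G: "((\<lambda>u. h\<^sup>2 * (u ^ (k + 2) * exp (- \<mu> * u\<^sup>2))) has_integral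
      h\<^sup>2 * integral {0..} (\<lambda>u. u ^ (k + 2) * exp (- \<mu> * u\<^sup>2))) {0..}"
      by (intro has_integral_mult_right integrable_integral power_mult_gaussian_integrable assms)
    have "norm (?F u) \<le> ?G u" if "u \<in> {0..}" for u
    proof -
      have "norm (?F u) \<le> u ^ k * exp (- \<mu> * u\<^sup>2) * (h * u)\<^sup>2"
        unfolding real_norm_def abs_mult using that
        by (intro mult_mono abs_cos_add_sub_le) auto
      also have "\<dots> = ?G u"
        by (simp add: power_mult_distrib power_add power2_eq_square mult_ac)
      finally show ?thesis .
    qed
    from integral_norm_bound_integral[OF has_integral_integrable[OF F] has_integral_integrable[OF G] this]
    show ?thesis unfolding integral_unique[OF F] integral_unique[OF G] .
  qed
  then show "\<bar>osc_int k \<mu> \<epsilon> \<theta> (y + h) - osc_int k \<mu> \<epsilon> \<theta> y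
      - h * osc_int (Suc k) \<mu> \<epsilon> (\<theta> + pi / 2) y\<bar>
      \<le> integral {0..} (\<lambda>u. u ^ (k + 2) * exp (- \<mu> * u\<^sup>2)) * h\<^sup>2"
    unfolding real_norm_def by (simp only: mult.commute)
qed

section \<open>Contour shift for the Airy integral\<close>

lemma airy_integrand_shift:
  "exp (\<i> * ((Complex s a) ^ 3 / 3 + of_real x * Complex s a))
    = of_real (exp (a ^ 3 / 3 - x * a - a * s\<^sup>2)) * cis (s ^ 3 / 3 + (x - a\<^sup>2) * s)"
proof -
  have "\<i> * ((Complex s a) ^ 3 / 3 + of_real x * Complex s a)
      = Complex (a ^ 3 / 3 - x * a - a * s\<^sup>2) (s ^ 3 / 3 + (x - a\<^sup>2) * s)"
    by (simp add: complex_eq_iff power3_eq_cube power2_eq_square field_simps)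
  then show ?thesis by (simp only: exp_eq_polar complex.sel)
qed

text \<open>Cauchy's theorem on the rectangle with corners 0, \<open>R\<close>,
  \<open>Complex R a\<close>, \<open>Complex 0 a\<close>. The left side contributes no real part,
  and on the right side the integrand decays like \<open>exp (- R\<^sup>2 * t)\<close>, which
  integrates to at most a constant over \<open>R\<^sup>2\<close>.\<close>

lemma airy_integral_shift_finite:
  fixes x a R :: real
  assumes a: "a > 0" and R: "R > 0"
  shows "\<bar>integral {0..R} (\<lambda>s. cos (s ^ 3 / 3 + x * s))
      - integral {0..R} (\<lambda>s. exp (a ^ 3 / 3 - x * a - a * s\<^sup>2) * cos (s ^ 3 / 3 + (x - a\<^sup>2) * s))\<bar>
      \<le> exp (a ^ 3 / 3 + \<bar>x\<bar> * a) / R\<^sup>2"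
proof -
  define f where "f = (\<lambda>z. exp (\<i> * (z ^ 3 / 3 + of_real x * z)))"
  have f: "f (Complex s t) = of_real (exp (t ^ 3 / 3 - x * t - t * s\<^sup>2)) * cis (s ^ 3 / 3 + (x - t\<^sup>2) * s)"
    for s t unfolding f_def by (rule airy_integrand_shift)
  have "f holomorphic_on UNIV"
    unfolding f_def by (intro holomorphic_intros) auto
  \<comment> \<open>With an entire primitive \<open>g\<close>, each side of the rectangle is a
    difference of values of \<open>g\<close>, and no path integrals are needed.\<close>
  then obtain g where g: "\<And>z. (g has_field_derivative f z) (at z)"
    using holomorphic_convex_primitive'[of UNIV f] by auto
  have horiz: "((\<lambda>s. Re (g (Complex s t))) has_vector_derivative Re (f (Complex s t))) (at s within S)"
    for s t S
  proof -
    have "((\<lambda>s. Complex s t) has_vector_derivative 1) (at s)"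
      by (simp add: has_vector_derivative_complex_iff)
    from field_vector_diff_chain_at[OF this g]
    have "((\<lambda>s. Re (g (Complex s t))) has_real_derivative Re (f (Complex s t))) (at s)"
      by (simp add: has_vector_derivative_complex_iff o_def)
    then show ?thesis
      by (simp add: has_real_derivative_iff_has_vector_derivative has_vector_derivative_at_within)
  qed
  have vert: "((\<lambda>t. g (Complex s t)) has_vector_derivative \<i> * f (Complex s t)) (at t)" for s t
  proof -
    have "((\<lambda>t. Complex s t) has_vector_derivative \<i>) (at t)"
      by (simp add: has_vector_derivative_complex_iff)
    from field_vector_diff_chain_at[OF this g] show ?thesis by (simp add: o_def)
  qed
  have I: "integral {0..R} (\<lambda>s. Re (f (Complex s t))) = Re (g (Complex R t)) - Re (g (Complex 0 t))" for t
    by (rule integral_unique[OF fundamental_theorem_of_calculus]) (use R horiz in auto)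
  \<comment> \<open>The comparison function is an antiderivative of
    \<open>exp (a ^ 3 / 3 + \<bar>x\<bar> * a) * exp (- R\<^sup>2 * t)\<close>, which dominates the
    integrand for \<open>t\<close> between 0 and \<open>a\<close>.\<close>
  have side: "norm (g (Complex R a) - g (Complex R 0))
      \<le> (- exp (a ^ 3 / 3 + \<bar>x\<bar> * a) * exp (- R\<^sup>2 * a) / R\<^sup>2) - (- exp (a ^ 3 / 3 + \<bar>x\<bar> * a) * exp (- R\<^sup>2 * 0) / R\<^sup>2)"
  proof (rule differentiable_bound_general[OF a])
    show "continuous_on {0..a} (\<lambda>t. g (Complex R t))"
      by (intro continuous_at_imp_continuous_on ballI has_vector_derivative_continuous[OF vert])
    show "continuous_on {0..a} (\<lambda>t. - exp (a ^ 3 / 3 + \<bar>x\<bar> * a) * exp (- R\<^sup>2 * t) / R\<^sup>2)"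
      using R by (intro continuous_intros) auto
    fix t assume t: "0 < t" "t < a"
    show "((\<lambda>t. g (Complex R t)) has_vector_derivative \<i> * f (Complex R t)) (at t)"
      by (rule vert)
    show "((\<lambda>t. - exp (a ^ 3 / 3 + \<bar>x\<bar> * a) * exp (- R\<^sup>2 * t) / R\<^sup>2) has_vector_derivative
       exp (a ^ 3 / 3 + \<bar>x\<bar> * a) * exp (- R\<^sup>2 * t)) (at t)"
      unfolding has_real_derivative_iff_has_vector_derivative[symmetric]
      using R by (auto intro!: derivative_eq_intros simp: power2_eq_square)
    have "- x * t \<le> \<bar>x\<bar> * a"
      using t by (intro mult_mono) auto
    moreover have "t ^ 3 \<le> a ^ 3" using t by (intro power_mono) auto
    ultimately show "norm (\<i> * f (Complex R t)) \<le> exp (a ^ 3 / 3 + \<bar>x\<bar> * a) * exp (- R\<^sup>2 * t)"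
      by (simp add: f norm_mult flip: exp_add)
  qed
  \<comment> \<open>On the imaginary axis \<open>f\<close> is real, so the derivative
    \<open>\<i> * f\<close> of \<open>g\<close> along it is purely imaginary and the real part of
    \<open>g\<close> stays constant.\<close>
  have left: "Re (g (Complex 0 a)) = Re (g (Complex 0 0))"
  proof (rule DERIV_isconst_all[where f = "\<lambda>t. Re (g (Complex 0 t))"], rule allI)
    fix t
    have "((\<lambda>t. Re (g (Complex 0 t))) has_vector_derivative Re (\<i> * f (Complex 0 t))) (at t)"
      using vert[of 0 t] by (simp only: has_vector_derivative_complex_iff
        has_real_derivative_iff_has_vector_derivative)
    also have "Re (\<i> * f (Complex 0 t)) = 0" by (simp add: f)
    finally show "((\<lambda>t. Re (g (Complex 0 t))) has_real_derivative 0) (at t)"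
      by (simp only: has_real_derivative_iff_has_vector_derivative)
  qed
  have "integral {0..R} (\<lambda>s. cos (s ^ 3 / 3 + x * s))
      - integral {0..R} (\<lambda>s. exp (a ^ 3 / 3 - x * a - a * s\<^sup>2) * cos (s ^ 3 / 3 + (x - a\<^sup>2) * s))
      = - Re (g (Complex R a) - g (Complex R 0))"
    using I[of 0] I[of a] left by (simp add: f)
  also have "\<bar>\<dots>\<bar> \<le> norm (g (Complex R a) - g (Complex R 0))"
    unfolding abs_minus_cancel by (rule abs_Re_le_cmod)
  also have "\<dots> \<le> exp (a ^ 3 / 3 + \<bar>x\<bar> * a) / R\<^sup>2"
    by (rule order_trans[OF side]) simp
  finally show ?thesis .
qed

text \<open>The shifted integral converges absolutely, and its truncations differ from those of the
  Airy integral by O(1/R^2). This yields both the convergence of the Airy integral and its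
  value.\<close>

lemma has_integral_airy:
  fixes x a :: real
  assumes a: "a > 0"
  shows "((\<lambda>s. cos (s ^ 3 / 3 + x * s)) has_integral exp (a ^ 3 / 3 - x * a) * osc_int 0 a 1 0 (x - a\<^sup>2)) {0..}"
proof -
  define u where "u = (\<lambda>s::real. exp (a ^ 3 / 3 - x * a - a * s\<^sup>2) * cos (s ^ 3 / 3 + (x - a\<^sup>2) * s))"
  have u: "u = (\<lambda>s. exp (a ^ 3 / 3 - x * a) * (s ^ 0 * exp (- a * s\<^sup>2) * cos (1 * s ^ 3 / 3 + (x - a\<^sup>2) * s + 0)))"
    by (simp add: u_def flip: exp_add mult.assoc)
  have "(u has_integral exp (a ^ 3 / 3 - x * a) * osc_int 0 a 1 0 (x - a\<^sup>2)) {0..}"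
    unfolding u osc_int_def using osc_int_integrable[OF a]
    by (intro has_integral_mult_right integrable_integral)
  then have lim: "((\<lambda>R. integral {0..R} u) \<longlongrightarrow> exp (a ^ 3 / 3 - x * a) * osc_int 0 a 1 0 (x - a\<^sup>2)) at_top"
    by (simp add: has_integral_atLeast_iff_tendsto)
  have "((\<lambda>R. integral {0..R} (\<lambda>s. cos (s ^ 3 / 3 + x * s)) - integral {0..R} u) \<longlongrightarrow> 0) at_top"
  proof (rule Lim_null_comparison)
    show "\<forall>\<^sub>F R in at_top. norm (integral {0..R} (\<lambda>s. cos (s ^ 3 / 3 + x * s)) - integral {0..R} u)
        \<le> exp (a ^ 3 / 3 + \<bar>x\<bar> * a) / R\<^sup>2"
      using eventually_gt_at_top[of 0]
      by eventually_elim (use airy_integral_shift_finite[OF a] in \<open>simp add: u_def\<close>)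
    show "((\<lambda>R. exp (a ^ 3 / 3 + \<bar>x\<bar> * a) / R\<^sup>2) \<longlongrightarrow> 0) at_top"
      by real_asymp
  qed
  from tendsto_add[OF this lim]
  show ?thesis
    by (auto simp: has_integral_atLeast_iff_tendsto intro!: integrable_continuous_real continuous_intros)
qed

lemma airy_Ai_shift:
  assumes "a > 0"
  shows "airy_Ai x = exp (a ^ 3 / 3 - x * a) / pi * osc_int 0 a 1 0 (x - a\<^sup>2)"
  using integral_unique[OF has_integral_airy[OF assms, of x]] by (simp add: airy_Ai_def)

section \<open>Rescaling of the deformed Airy function\<close>

lemma osc_int_scale:
  assumes "m > 0"
  shows "osc_int 0 \<mu> \<epsilon> 0 y = m * osc_int 0 (\<mu> * m\<^sup>2) (\<epsilon> * m ^ 3) 0 (y * m)"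
  using integral_atLeast_scale[OF assms, of 0 "\<lambda>u. u ^ 0 * exp (- \<mu> * u\<^sup>2) * cos (\<epsilon> * u ^ 3 / 3 + y * u + 0)"] assms
  by (simp add: osc_int_def power_mult_distrib mult_ac)

text \<open>For \<epsilon> = \<open>1 / b ^ 3\<close> this is
  \<open>b * deformed_Ai b (b * q)\<close>, evaluated on the contour at height
  \<open>b\<^sup>2 / 2 + c / b\<close>. The offset \<open>c\<close> stays a parameter because
  different values expose different properties of the same function.\<close>

definition rescaled_Ai :: "real \<Rightarrow> real \<Rightarrow> real \<Rightarrow> real" where
  "rescaled_Ai \<epsilon> c q = exp (c\<^sup>2 / 2 + \<epsilon> * c ^ 3 / 3 - c * q) / pi
     * osc_int 0 (1 / 2 + \<epsilon> * c) \<epsilon> 0 (q - c - \<epsilon> * c\<^sup>2)"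

lemma deformed_Ai_eq_rescaled:
  assumes b: "b > 0" and c: "c \<ge> 0"
  shows "deformed_Ai b \<zeta> = rescaled_Ai (1 / b ^ 3) c (\<zeta> / b) / b"
proof -
  define h where "h = c / b"
  define a where "a = b\<^sup>2 / 2 + h"
  have a: "a > 0" unfolding a_def h_def using b c by (intro add_pos_nonneg) auto
  have ch: "c = h * b" using b by (simp add: h_def)
  let ?x = "\<zeta> + b ^ 4 / 4"
  \<comment> \<open>The height \<open>b\<^sup>2 / 2\<close> is the saddle of the Airy phase at
    \<open>b ^ 4 / 4\<close>. Hence the terms in \<open>b ^ 6\<close> and in
    \<open>b\<^sup>2 * \<zeta>\<close> cancel against the prefactor, and only terms in the offset
    \<open>h\<close> remain.\<close>
  have "b\<^sup>2 * \<zeta> / 2 + b ^ 6 / 12 + (a ^ 3 / 3 - ?x * a) = b\<^sup>2 * h\<^sup>2 / 2 + h ^ 3 / 3 - h * \<zeta>"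
    unfolding a_def by (simp add: field_simps power2_eq_square power3_eq_cube power4_eq_xxxx eval_nat_numeral)
  also have "\<dots> = c\<^sup>2 / 2 + 1 / b ^ 3 * c ^ 3 / 3 - c * (\<zeta> / b)"
    unfolding ch using b by (simp add: power_mult_distrib)
  finally have e: "b\<^sup>2 * \<zeta> / 2 + b ^ 6 / 12 + (a ^ 3 / 3 - ?x * a)
      = c\<^sup>2 / 2 + 1 / b ^ 3 * c ^ 3 / 3 - c * (\<zeta> / b)" .
  have m: "a * (1 / b)\<^sup>2 = 1 / 2 + 1 / b ^ 3 * c"
    unfolding a_def ch using b by (simp add: field_simps power2_eq_square power3_eq_cube)
  have "?x - a\<^sup>2 = \<zeta> - b\<^sup>2 * h - h\<^sup>2"
    unfolding a_def by (simp add: field_simps power2_eq_square power4_eq_xxxx)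
  then have y: "(?x - a\<^sup>2) * (1 / b) = \<zeta> / b - c - 1 / b ^ 3 * c\<^sup>2"
    unfolding ch \<open>?x - a\<^sup>2 = _\<close> using b by (simp add: field_simps power2_eq_square power3_eq_cube)
  have "deformed_Ai b \<zeta> = exp (b\<^sup>2 * \<zeta> / 2 + b ^ 6 / 12 + (a ^ 3 / 3 - ?x * a)) / pi
      * osc_int 0 a 1 0 (?x - a\<^sup>2)"
    unfolding deformed_Ai_def airy_Ai_shift[OF a] exp_add by simp
  also have "osc_int 0 a 1 0 (?x - a\<^sup>2)
      = osc_int 0 (1 / 2 + 1 / b ^ 3 * c) (1 / b ^ 3) 0 (\<zeta> / b - c - 1 / b ^ 3 * c\<^sup>2) / b"
    using osc_int_scale[of "1 / b" a 1 "?x - a\<^sup>2"] b unfolding m y by (simp add: power_divide)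
  finally show ?thesis unfolding rescaled_Ai_def e by simp
qed

text \<open>Both sides compute the same value of \<open>deformed_Ai\<close> for the \<open>b\<close>
  with \<open>1 / b ^ 3\<close> equal to \<epsilon>, on two different contours.\<close>

lemma rescaled_Ai_shift:
  assumes "\<epsilon> > 0" and "c \<ge> 0"
  shows "rescaled_Ai \<epsilon> c q = rescaled_Ai \<epsilon> 0 q"
proof -
  define b where "b = root 3 (1 / \<epsilon>)"
  have b: "b > 0" "1 / b ^ 3 = \<epsilon>"
    using assms by (auto simp: b_def odd_real_root_pow)
  then show ?thesis
    using deformed_Ai_eq_rescaled[OF b(1) assms(2), of "b * q"]
      deformed_Ai_eq_rescaled[OF b(1) order_refl, of "b * q"] by simp
qed

section \<open>The pointwise limit as \<epsilon> tends to 0\<close>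

text \<open>By evenness this is half of the Fourier integral of a Gaussian over the line, which is
  known as the characteristic function of the standard normal distribution.\<close>

lemma osc_int_gaussian: "osc_int 0 (1 / 2) 0 0 q = sqrt (pi / 2) * exp (- q\<^sup>2 / 2)"
proof -
  define f where "f = (\<lambda>u::real. exp (- u\<^sup>2 / 2) * cos (q * u))"
  have f: "f = (\<lambda>u. u ^ 0 * exp (- (1 / 2) * u\<^sup>2) * cos (0 * u ^ 3 / 3 + q * u + 0))"
    by (auto simp: f_def)
  have abs: "f absolutely_integrable_on {0..}"
    unfolding f by (rule integrable_gaussian_bounded[where C = 1]) (auto intro!: continuous_intros)
  \<comment> \<open>Absolute integrability allows the passage from the gauge integral to the
    Lebesgue integral, in which the characteristic function is stated.\<close>
  have "integral {0..} f = (\<integral>x. indicator {0..} x *\<^sub>R f x \<partial>lebesgue)"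
    using set_lebesgue_integral_eq_integral(2)[OF abs] by (simp add: set_lebesgue_integral_def)
  also have "\<dots> = (\<integral>x. indicator {0..} x *\<^sub>R f x \<partial>lborel)"
    by (rule integral_completion) (simp add: f_def)
  finally have "has_bochner_integral lborel (\<lambda>x. indicator {0..} x *\<^sub>R f x) (osc_int 0 (1 / 2) 0 0 q)"
    using abs by (auto simp: has_bochner_integral_iff set_integrable_def osc_int_def f f_def[symmetric]
        integrable_completion)
  from has_bochner_integral_even_function[OF this]
  have half: "(\<integral>x. f x \<partial>lborel) = 2 * osc_int 0 (1 / 2) 0 0 q"
    by (auto simp: has_bochner_integral_iff f_def)
  have "exp (- q\<^sup>2 / 2) = Re (char std_normal_distribution q)"
    by (simp add: char_std_normal_distribution)
  also have "\<dots> = Re (\<integral>x. std_normal_density x *\<^sub>R iexp (q * x) \<partial>lborel)"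
    unfolding char_def by (subst integral_density) auto
  also have "\<dots> = (\<integral>x. Re (std_normal_density x *\<^sub>R iexp (q * x)) \<partial>lborel)"
    by (rule integral_Re[symmetric], rule Bochner_Integration.integrable_bound[OF integrable_normal_density[of 1 0]])
      auto
  also have "\<dots> = (\<integral>x. f x / sqrt (2 * pi) \<partial>lborel)"
    by (simp add: f_def std_normal_density_def Re_exp)
  also have "\<dots> = 2 * osc_int 0 (1 / 2) 0 0 q / sqrt (2 * pi)"
    by (simp add: half)
  finally have "osc_int 0 (1 / 2) 0 0 q = sqrt (2 * pi) / 2 * exp (- q\<^sup>2 / 2)"
    by (simp add: field_simps)
  also have "sqrt (2 * pi) / 2 = sqrt (pi / 2)"
    by (simp add: real_sqrt_mult real_sqrt_divide field_simps)
  finally show ?thesis .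
qed

text \<open>Only the phase depends on \<epsilon>, so the damped power is a majorant for every
  \<epsilon>, and dominated convergence applies along each sequence.\<close>

lemma tendsto_osc_int:
  assumes "\<mu> > 0"
  shows "((\<lambda>\<epsilon>. osc_int k \<mu> \<epsilon> \<theta> y) \<longlongrightarrow> osc_int k \<mu> 0 \<theta> y) (at 0 within S)"
  unfolding tendsto_at_iff_sequentially
proof (intro allI impI)
  fix X :: "nat \<Rightarrow> real" assume "X \<longlonglongrightarrow> 0"
  then show "((\<lambda>\<epsilon>. osc_int k \<mu> \<epsilon> \<theta> y) \<circ> X) \<longlonglongrightarrow> osc_int k \<mu> 0 \<theta> y"
    unfolding osc_int_def o_def
    by (intro dominated_convergence(2)[where h = "\<lambda>u. u ^ k * exp (- \<mu> * u\<^sup>2)"]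
         osc_int_integrable power_mult_gaussian_integrable assms)
       (auto simp: abs_mult intro!: mult_left_le tendsto_eq_intros)
qed

text \<open>The limit is read off at \<open>c = 0\<close>, where no exponential prefactor is left,
  and transferred to \<open>c = 1\<close>, the representation whose decay is used later. The filter
  stays in the range of \<epsilon> where the uniform bounds hold.\<close>

lemma tendsto_rescaled_Ai:
  "((\<lambda>\<epsilon>. rescaled_Ai \<epsilon> 1 q) \<longlongrightarrow> exp (- q\<^sup>2 / 2) / sqrt (2 * pi)) (at 0 within {0<..1})"
proof -
  have "((\<lambda>\<epsilon>. osc_int 0 (1 / 2) \<epsilon> 0 q / pi) \<longlongrightarrow> osc_int 0 (1 / 2) 0 0 q / pi) (at 0 within {0<..1})"
    by (intro tendsto_intros tendsto_osc_int) auto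
  also have "osc_int 0 (1 / 2) 0 0 q / pi = exp (- q\<^sup>2 / 2) / sqrt (2 * pi)"
    by (simp add: osc_int_gaussian real_sqrt_mult real_sqrt_divide field_simps)
  finally show ?thesis
    by (rule Lim_transform_eventually)
      (auto simp: eventually_at_filter rescaled_Ai_shift rescaled_Ai_def[where c = 0])
qed

section \<open>Uniform exponential bounds and integrability\<close>

text \<open>At \<open>c = 1\<close> the function is \<open>exp (- q)\<close> times a bounded
  constant times an oscillatory integral, and each derivative of that integral is bounded by a
  Gaussian moment. The product rule gives \<open>W1\<close> and \<open>W2\<close>, and the factor
  \<open>exp (- q)\<close> survives as decay at infinity.\<close>

lemma rescaled_Ai_derivatives:
  obtains D W1 W2 where "\<And>\<epsilon> q. \<epsilon> > 0 \<Longrightarrow> (rescaled_Ai \<epsilon> 1 has_real_derivative W1 \<epsilon> q) (at q)"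
    and "\<And>\<epsilon> q. \<epsilon> > 0 \<Longrightarrow> (W1 \<epsilon> has_real_derivative W2 \<epsilon> q) (at q)"
    and "\<And>\<epsilon>. \<epsilon> > 0 \<Longrightarrow> continuous_on UNIV (W2 \<epsilon>)"
    and "\<And>\<epsilon> q. \<epsilon> \<in> {0<..1} \<Longrightarrow> \<bar>rescaled_Ai \<epsilon> 1 q\<bar> \<le> D * exp (- q)"
    and "\<And>\<epsilon> q. \<epsilon> \<in> {0<..1} \<Longrightarrow> \<bar>W1 \<epsilon> q\<bar> \<le> D * exp (- q)"
    and "\<And>\<epsilon> q. \<epsilon> \<in> {0<..1} \<Longrightarrow> \<bar>W2 \<epsilon> q\<bar> \<le> D * exp (- q)"
proof
  define C :: "real \<Rightarrow> real" where "C = (\<lambda>\<epsilon>. exp (1 / 2 + \<epsilon> / 3) / pi)"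
  \<comment> \<open>The phase \<open>k * (pi / 2)\<close> matches the advance under differentiation,
    so the derivative of \<open>K k\<close> is \<open>K (Suc k)\<close>.\<close>
  define K where "K = (\<lambda>k \<epsilon> q. osc_int k (1 / 2 + \<epsilon>) \<epsilon> (real k * (pi / 2)) (q - 1 - \<epsilon>))"
  define M where "M = (\<lambda>k. osc_int k (1 / 2) 0 0 0)"
  define W1 where "W1 = (\<lambda>\<epsilon> q. C \<epsilon> * exp (- q) * (K 1 \<epsilon> q - K 0 \<epsilon> q))"
  define W2 where "W2 = (\<lambda>\<epsilon> q. C \<epsilon> * exp (- q) * (K 2 \<epsilon> q - 2 * K 1 \<epsilon> q + K 0 \<epsilon> q))"
  \<comment> \<open>The factor \<open>exp 1\<close> dominates \<open>C \<epsilon>\<close> for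
    \<epsilon> \<le> 1. The weights 1, 2, 1 come from the second derivative and also cover the
    function and its first derivative.\<close>
  define D where "D = exp 1 * (M 2 + 2 * M 1 + M 0)"
  have W0: "rescaled_Ai \<epsilon> 1 = (\<lambda>q. C \<epsilon> * exp (- q) * K 0 \<epsilon> q)" for \<epsilon>
    by (auto simp: rescaled_Ai_def C_def K_def simp flip: exp_add)
  have K': "(K k \<epsilon> has_real_derivative K (Suc k) \<epsilon> q) (at q)" if "\<epsilon> > 0" for k \<epsilon> q
  proof -
    have "real (Suc k) * (pi / 2) = real k * (pi / 2) + pi / 2" by (simp add: algebra_simps)
    moreover have "((\<lambda>q. q - 1 - \<epsilon>) has_real_derivative 1) (at q)"
      by (auto intro!: derivative_eq_intros)
    then have "((\<lambda>q. osc_int k (1 / 2 + \<epsilon>) \<epsilon> (real k * (pi / 2)) (q - 1 - \<epsilon>)) has_real_derivative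
        osc_int (Suc k) (1 / 2 + \<epsilon>) \<epsilon> (real k * (pi / 2) + pi / 2) (q - 1 - \<epsilon>) * 1) (at q)"
      by (rule DERIV_chain2[OF osc_int_has_derivative, rotated]) (use that in simp)
    ultimately show ?thesis unfolding K_def by (simp only: mult_1_right)
  qed
  have K: "\<bar>K k \<epsilon> q\<bar> \<le> M k" if "\<epsilon> > 0" for k \<epsilon> q
    using that unfolding K_def M_def by (intro abs_osc_int_le) auto
  have M: "M k \<ge> 0" for k
    using K[of 1 k 0] by simp
  have bound: "\<bar>C \<epsilon> * exp (- q) * X\<bar> \<le> D * exp (- q)"
    if "\<epsilon> \<in> {0<..1}" "\<bar>X\<bar> \<le> M 2 + 2 * M 1 + M 0" for \<epsilon> q X
  proof -
    have "exp (1 / 2 + \<epsilon> / 3) * 1 \<le> exp 1 * pi"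
      using that pi_gt3 by (intro mult_mono) auto
    then have "C \<epsilon> \<le> exp 1" by (simp add: C_def field_simps)
    moreover have "C \<epsilon> \<ge> 0" by (simp add: C_def)
    ultimately have "C \<epsilon> * \<bar>X\<bar> * exp (- q) \<le> exp 1 * (M 2 + 2 * M 1 + M 0) * exp (- q)"
      using that by (intro mult_mono mult_right_mono) auto
    then show ?thesis using \<open>C \<epsilon> \<ge> 0\<close> by (simp add: D_def abs_mult mult_ac)
  qed
  fix \<epsilon> :: real
  {
    assume \<epsilon>: "\<epsilon> > 0"
    note [derivative_intros] = K'[OF \<epsilon>, THEN DERIV_chain2]
    show "(rescaled_Ai \<epsilon> 1 has_real_derivative W1 \<epsilon> q) (at q)" for q
      unfolding W0 W1_def by (auto intro!: derivative_eq_intros simp: algebra_simps)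
    show "(W1 \<epsilon> has_real_derivative W2 \<epsilon> q) (at q)" for q
      unfolding W1_def W2_def
      by (auto intro!: derivative_eq_intros simp: algebra_simps numeral_2_eq_2)
    have "continuous_on UNIV (K k \<epsilon>)" for k
      using K'[OF \<epsilon>] by (intro continuous_at_imp_continuous_on ballI DERIV_isCont)
    then show "continuous_on UNIV (W2 \<epsilon>)"
      unfolding W2_def by (intro continuous_intros)
  }
  {
    fix q assume \<epsilon>: "\<epsilon> \<in> {0<..1}"
    then have "\<bar>K 0 \<epsilon> q\<bar> \<le> M 0" "\<bar>K 1 \<epsilon> q\<bar> \<le> M 1" "\<bar>K 2 \<epsilon> q\<bar> \<le> M 2"
      using K by auto
    then show "\<bar>rescaled_Ai \<epsilon> 1 q\<bar> \<le> D * exp (- q)" "\<bar>W1 \<epsilon> q\<bar> \<le> D * exp (- q)"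
      "\<bar>W2 \<epsilon> q\<bar> \<le> D * exp (- q)"
      unfolding W0 W1_def W2_def using M[of 0] M[of 1] M[of 2] \<epsilon> by (intro bound; linarith)+
  }
qed

lemma integrable_exp_minus_two_mult: "(\<lambda>q::real. C * exp (- (2 * q))) integrable_on {c..}"
  using integrable_on_cmult_left[OF integrable_on_exp_minus_to_infinity[of 2 c], of C] by simp

lemma integrable_bounded_exp:
  fixes f :: "real \<Rightarrow> real"
  assumes "continuous_on UNIV f" and "\<And>q. \<bar>f q\<bar> \<le> C * exp (- (2 * q))"
  shows "f integrable_on {c..}"
  using assms(2)
  by (intro measurable_bounded_by_integrable_imp_integrable[OF _ integrable_exp_minus_two_mult[of C c]]
       continuous_imp_measurable_on_sets_lebesgue continuous_on_subset[OF assms(1)]) auto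

lemma abs_mult_exp_bound:
  fixes x y D q :: real
  assumes "\<bar>x\<bar> \<le> D * exp (- q)" and "\<bar>y\<bar> \<le> D * exp (- q)"
  shows "\<bar>x * y\<bar> \<le> D\<^sup>2 * exp (- (2 * q))"
proof -
  have "\<bar>x * y\<bar> \<le> (D * exp (- q)) * (D * exp (- q))"
    unfolding abs_mult using assms by (intro mult_mono) auto
  also have "\<dots> = D\<^sup>2 * exp (- (2 * q))"
    by (simp add: power2_eq_square algebra_simps flip: exp_add)
  finally show ?thesis .
qed

lemma integral_gaussian_square:
  "integral {c..} (\<lambda>q. (exp (- q\<^sup>2 / 2) / sqrt (2 * pi))\<^sup>2)
    = integral {sqrt 2 * c..} (\<lambda>p. exp (- p\<^sup>2 / 2)) / (2 * pi * sqrt 2)"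
proof -
  have "(exp (- q\<^sup>2 / 2) / sqrt (2 * pi))\<^sup>2 = exp (- (sqrt 2 * q)\<^sup>2 / 2) / (2 * pi)" for q :: real
    by (simp add: power_divide power_mult_distrib flip: exp_double)
  then show ?thesis
    using integral_atLeast_scale[of "sqrt 2" c "\<lambda>p. exp (- p\<^sup>2 / 2)"] by simp
qed

section \<open>The limit of the density\<close>

theorem corollary2p5:
  fixes \<delta> \<sigma> :: real
  assumes "\<sigma> > 0"
  shows "((\<lambda>b::real. 2 * b ^ 4 * P_we b (sqrt 2 * b * \<delta>) (sqrt 2 * b ^ 3 * \<sigma>)) \<longlongrightarrow>
          1 / (4 * pi * \<sigma>\<^sup>2) * exp (\<delta> / \<sigma> - 1 / (4 * \<sigma>\<^sup>2))
            * (exp (- 2 * \<delta>\<^sup>2)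
               + (1 / \<sigma> - 2 * \<delta>) * integral {2 * \<delta>..} (\<lambda>p. exp (- p\<^sup>2 / 2)))) at_top"
proof -
  obtain D W1 W2 where
    W1: "\<And>\<epsilon> q. \<epsilon> > 0 \<Longrightarrow> (rescaled_Ai \<epsilon> 1 has_real_derivative W1 \<epsilon> q) (at q)"
    and W2: "\<And>\<epsilon> q. \<epsilon> > 0 \<Longrightarrow> (W1 \<epsilon> has_real_derivative W2 \<epsilon> q) (at q)"
    and cont2: "\<And>\<epsilon>. \<epsilon> > 0 \<Longrightarrow> continuous_on UNIV (W2 \<epsilon>)"
    and bd: "\<And>\<epsilon> q. \<epsilon> \<in> {0<..1} \<Longrightarrow> \<bar>rescaled_Ai \<epsilon> 1 q\<bar> \<le> D * exp (- q)"
      "\<And>\<epsilon> q. \<epsilon> \<in> {0<..1} \<Longrightarrow> \<bar>W1 \<epsilon> q\<bar> \<le> D * exp (- q)"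
      "\<And>\<epsilon> q. \<epsilon> \<in> {0<..1} \<Longrightarrow> \<bar>W2 \<epsilon> q\<bar> \<le> D * exp (- q)"
    by (rule rescaled_Ai_derivatives, rule that)
  have cont0: "continuous_on UNIV (rescaled_Ai \<epsilon> 1)" and cont1: "continuous_on UNIV (W1 \<epsilon>)"
    if "\<epsilon> > 0" for \<epsilon>
    using W1[OF that] W2[OF that] by (auto intro!: continuous_at_imp_continuous_on DERIV_isCont)
  \<comment> \<open>This is the rescaled position: the point \<open>sqrt 2 * b * \<delta>\<close>
    divided by \<open>b\<close>.\<close>
  define q0 where "q0 = sqrt 2 * \<delta>"
  define \<phi> where "\<phi> = (\<lambda>q::real. exp (- q\<^sup>2 / 2) / sqrt (2 * pi))"
  define N where "N = (\<lambda>\<epsilon>. integral {q0..} (\<lambda>q. (rescaled_Ai \<epsilon> 1 q)\<^sup>2))"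
  define S where "S = (\<lambda>\<epsilon>. integral {q0..} (\<lambda>q. (W1 \<epsilon> q)\<^sup>2 - rescaled_Ai \<epsilon> 1 q * W2 \<epsilon> q))"
  define B where "B = integral {q0..} (\<lambda>q. 2 * D\<^sup>2 * exp (- (2 * q)))"

  have N_lim: "(N \<longlongrightarrow> integral {q0..} (\<lambda>q. (\<phi> q)\<^sup>2)) (at 0 within {0<..1})"
    unfolding tendsto_at_iff_sequentially
  proof (intro allI impI)
    fix X :: "nat \<Rightarrow> real" assume X: "\<forall>i. X i \<in> {0<..1} - {0}" "X \<longlonglongrightarrow> 0"
    \<comment> \<open>Squaring the bound obtained at \<open>c = 1\<close> gives one majorant for the
      whole sequence, integrable on \<open>{q0..}\<close>.\<close>
    have bdX: "\<bar>(rescaled_Ai (X k) 1 q)\<^sup>2\<bar> \<le> D\<^sup>2 * exp (- (2 * q))" for k q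
      using abs_mult_exp_bound[OF bd(1) bd(1)] X(1) unfolding power2_eq_square[of "rescaled_Ai _ _ _"] by blast
    show "(N \<circ> X) \<longlonglongrightarrow> integral {q0..} (\<lambda>q. (\<phi> q)\<^sup>2)"
      unfolding N_def o_def
    proof (rule dominated_convergence(2)[OF _ integrable_exp_minus_two_mult])
      show "(\<lambda>q. (rescaled_Ai (X k) 1 q)\<^sup>2) integrable_on {q0..}" for k
        using X(1) by (intro integrable_bounded_exp[OF _ bdX] continuous_intros cont0) auto
      show "norm ((rescaled_Ai (X k) 1 q)\<^sup>2) \<le> D\<^sup>2 * exp (- (2 * q))" for k q
        using bdX by simp
      show "(\<lambda>k. (rescaled_Ai (X k) 1 q)\<^sup>2) \<longlonglongrightarrow> (\<phi> q)\<^sup>2" for q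
        using tendsto_rescaled_Ai[of q] X unfolding tendsto_at_iff_sequentially \<phi>_def o_def
        by (intro tendsto_intros) blast
    qed
  qed
  \<comment> \<open>Boundedness of \<open>S\<close> suffices: \<open>T3\<close> equals
    \<open>S (e b)\<close> divided by \<open>b ^ 3\<close>, so no limit of \<open>S\<close> has to
    be identified.\<close>
  have S_bd: "\<bar>S \<epsilon>\<bar> \<le> B" if "\<epsilon> \<in> {0<..1}" for \<epsilon>
  proof -
    let ?f = "\<lambda>q. (W1 \<epsilon> q)\<^sup>2 - rescaled_Ai \<epsilon> 1 q * W2 \<epsilon> q"
    have b: "\<bar>?f q\<bar> \<le> 2 * D\<^sup>2 * exp (- (2 * q))" for q
      using abs_mult_exp_bound[OF bd(2)[OF that] bd(2)[OF that], of q]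
        abs_mult_exp_bound[OF bd(1)[OF that] bd(3)[OF that], of q]
      unfolding power2_eq_square[of "W1 _ _"] by linarith
    have "?f integrable_on {q0..}"
      using that by (intro integrable_bounded_exp[OF _ b] continuous_intros cont0 cont1 cont2) auto
    then show ?thesis
      unfolding S_def B_def real_norm_def[symmetric]
      using b by (intro integral_norm_bound_integral integrable_exp_minus_two_mult) auto
  qed

  define e where "e = (\<lambda>b::real. 1 / b ^ 3)"
  have e_lim: "filterlim e (at 0 within {0<..1}) at_top"
    unfolding filterlim_at
  proof
    show "(e \<longlongrightarrow> 0) at_top" unfolding e_def by real_asymp
    show "\<forall>\<^sub>F b in at_top. e b \<in> {0<..1} \<and> e b \<noteq> 0"
      using eventually_ge_at_top[of 1] by eventually_elim (auto simp: e_def)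
  qed
  \<comment> \<open>The normalised ingredients at the evaluation point: \<open>deformed_Ai\<close>
    is \<open>w b / b\<close>, its product with its derivative is \<open>v b / b\<^sup>2\<close>,
    and \<open>T3\<close> is \<open>s b / b\<^sup>2\<close>. One factor \<open>1 / b\<close> is kept
    inside \<open>s\<close> and \<open>v\<close>, so that both tend to 0.\<close>
  define w where "w = (\<lambda>b. rescaled_Ai (e b) 1 q0)"
  define s where "s = (\<lambda>b. S (e b) / b)"
  define v where "v = (\<lambda>b. w b * W1 (e b) q0 / b)"
  have w: "(w \<longlongrightarrow> \<phi> q0) at_top"
    unfolding w_def \<phi>_def by (rule filterlim_compose[OF tendsto_rescaled_Ai e_lim])
  have n: "((\<lambda>b. N (e b)) \<longlongrightarrow> integral {q0..} (\<lambda>q. (\<phi> q)\<^sup>2)) at_top"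
    by (rule filterlim_compose[OF N_lim e_lim])
  have s: "(s \<longlongrightarrow> 0) at_top"
  proof (rule Lim_null_comparison)
    show "\<forall>\<^sub>F b in at_top. norm (s b) \<le> B / b"
      using eventually_ge_at_top[of 1]
      by eventually_elim (auto simp: s_def e_def intro!: divide_right_mono S_bd)
    show "((\<lambda>b. B / b) \<longlongrightarrow> 0) at_top" by real_asymp
  qed
  have v: "(v \<longlongrightarrow> 0) at_top"
  proof (rule Lim_null_comparison)
    show "\<forall>\<^sub>F b in at_top. norm (v b) \<le> D\<^sup>2 * exp (- (2 * q0)) / b"
      using eventually_ge_at_top[of 1]
    proof eventually_elim
      case (elim b)
      then have "e b \<in> {0<..1}" by (auto simp: e_def)
      from abs_mult_exp_bound[OF bd(1)[OF this] bd(2)[OF this]] elim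
      show ?case by (auto simp: v_def w_def abs_mult intro!: divide_right_mono)
    qed
    show "((\<lambda>b. D\<^sup>2 * exp (- (2 * q0)) / b) \<longlongrightarrow> 0) at_top" by real_asymp
  qed
  have r: "((\<lambda>b::real. 1 / b) \<longlongrightarrow> 0) at_top" by real_asymp

  \<comment> \<open>The scaled density written only through \<open>s\<close>, \<open>w\<close>,
    \<open>v\<close>, \<open>N (e b)\<close> and nonnegative powers of \<open>1 / b\<close>. The
    lines correspond to \<open>T0\<close>, \<open>T1\<close>, \<open>T2\<close>, \<open>T3\<close>
    and the exponential, and every ingredient has a limit.\<close>
  define L where "L = (\<lambda>b. 1 / \<sigma>\<^sup>2 * (- s b * (1 / b)\<^sup>2 + (w b)\<^sup>2 / 2 - v b * (1 / b)\<^sup>2 / 2 - q0 * N (e b)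
      + (- q0 * s b * (1 / b)\<^sup>2 + (w b)\<^sup>2 * (1 / b) ^ 3 / 2 + N (e b)) / (sqrt 2 * \<sigma>)
      + (s b * (1 / b)\<^sup>2 + N (e b) * (1 / b) ^ 3) / (2 * \<sigma>\<^sup>2)
      + s b * (1 / b) ^ 5 / (2 * sqrt 2 * \<sigma> ^ 3))
      * exp (\<delta> / \<sigma> - 1 / (4 * \<sigma>\<^sup>2) - (1 / b) ^ 3 / (6 * sqrt 2 * \<sigma> ^ 3)))"
  have eq: "2 * b ^ 4 * P_we b (sqrt 2 * b * \<delta>) (sqrt 2 * b ^ 3 * \<sigma>) = L b" if "b \<ge> 1" for b
  proof -
    have b: "b > 0" and eb: "e b > 0" using that by (auto simp: e_def)
    have dA: "deformed_Ai b = (\<lambda>p. rescaled_Ai (e b) 1 (p / b) / b)"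
      using deformed_Ai_eq_rescaled[OF b, of 1] by (auto simp: e_def)
    have d1: "deriv (deformed_Ai b) = (\<lambda>p. W1 (e b) (p / b) / b\<^sup>2)"
      unfolding dA using b
      by (intro ext DERIV_imp_deriv)
        (auto intro!: derivative_eq_intros DERIV_chain2[OF W1[OF eb]] simp: power2_eq_square)
    have d2: "deriv (deriv (deformed_Ai b)) = (\<lambda>p. W2 (e b) (p / b) / b ^ 3)"
      unfolding d1 using b
      by (intro ext DERIV_imp_deriv)
        (auto intro!: derivative_eq_intros DERIV_chain2[OF W2[OF eb]] simp: power2_eq_square power3_eq_cube)
    have \<zeta>: "sqrt 2 * b * \<delta> = b * q0" by (simp add: q0_def)
    have scale: "integral {b * q0..} f = b * integral {q0..} (\<lambda>q. f (b * q))" for f :: "real \<Rightarrow> real"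
      using integral_atLeast_scale[OF b] b by simp
    have iN: "integral {b * q0..} (\<lambda>p. (deformed_Ai b p)\<^sup>2) = N (e b) / b"
      unfolding scale dA N_def using b by (simp add: power_divide power2_eq_square)
    have t3: "T3 b (b * q0) = s b * (1 / b)\<^sup>2"
    proof -
      have "T3 b (b * q0) = b * integral {q0..} (\<lambda>q. ((W1 (e b) q)\<^sup>2 - rescaled_Ai (e b) 1 q * W2 (e b) q) / b ^ 4)"
        \<comment> \<open>The second derivative is rewritten first: \<open>d1\<close> and
          \<open>dA\<close> would otherwise change the inner terms that \<open>d2\<close> and
          \<open>d1\<close> have to match.\<close>
        unfolding T3_def scale d2 unfolding d1 unfolding dA using b
        by (simp add: power_divide diff_divide_distrib eval_nat_numeral mult.assoc)
      also have "\<dots> = s b * (1 / b)\<^sup>2"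
        using b by (simp add: s_def S_def power_divide eval_nat_numeral)
      finally show ?thesis .
    qed
    have t: "(sqrt 2 * b ^ 3 * \<sigma>)\<^sup>2 = 2 * b ^ 6 * \<sigma>\<^sup>2" "(sqrt 2 * b ^ 3 * \<sigma>) ^ 3 = 2 * sqrt 2 * b ^ 9 * \<sigma> ^ 3"
      by (simp_all add: power_mult_distrib power3_eq_cube[of "sqrt 2"] flip: power_mult)
    have A: "deformed_Ai b (b * q0) = w b / b" using b by (simp add: dA w_def)
    have A1: "deformed_Ai b (b * q0) * deriv (deformed_Ai b) (b * q0) = v b * (1 / b)\<^sup>2"
      unfolding A d1 using b by (simp add: v_def power2_eq_square)
    have T0: "T0 b (b * q0) = - s b * (1 / b)\<^sup>2 + (w b)\<^sup>2 / 2 - v b * (1 / b)\<^sup>2 / 2 - q0 * N (e b)"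
      unfolding T0_def iN t3 mult.assoc[of _ "deformed_Ai _ _" "deriv _ _"] A1 unfolding A
      using b by (simp add: power_divide)
    have T1: "b\<^sup>2 * T1 b (b * q0) / (sqrt 2 * b ^ 3 * \<sigma>)
      = (- q0 * s b * (1 / b)\<^sup>2 + (w b)\<^sup>2 * (1 / b) ^ 3 / 2 + N (e b)) / (sqrt 2 * \<sigma>)"
      unfolding T1_def iN t3 A using b assms
      by (simp add: power_divide field_simps power2_eq_square power3_eq_cube)
    have T2: "b ^ 4 * T2 b (b * q0) / (sqrt 2 * b ^ 3 * \<sigma>)\<^sup>2
      = (s b * (1 / b)\<^sup>2 + N (e b) * (1 / b) ^ 3) / (2 * \<sigma>\<^sup>2)"
      unfolding T2_def iN t3 t using b assms
      by (simp add: field_simps eval_nat_numeral)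
    have T3: "b ^ 6 * T3 b (b * q0) / (sqrt 2 * b ^ 3 * \<sigma>) ^ 3
      = s b * (1 / b) ^ 5 / (2 * sqrt 2 * \<sigma> ^ 3)"
      unfolding t3 t using b assms by (simp add: field_simps eval_nat_numeral)
    have ex: "b\<^sup>2 * (b * q0) / (sqrt 2 * b ^ 3 * \<sigma>) - b ^ 6 / (2 * (sqrt 2 * b ^ 3 * \<sigma>)\<^sup>2) - b ^ 6 / (3 * (sqrt 2 * b ^ 3 * \<sigma>) ^ 3)
      = \<delta> / \<sigma> - 1 / (4 * \<sigma>\<^sup>2) - (1 / b) ^ 3 / (6 * sqrt 2 * \<sigma> ^ 3)"
    proof -
      have "b\<^sup>2 * (b * q0) / (sqrt 2 * b ^ 3 * \<sigma>) = \<delta> / \<sigma>"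
        using b assms by (simp add: q0_def field_simps power2_eq_square power3_eq_cube)
      moreover have "b ^ 6 / (2 * (sqrt 2 * b ^ 3 * \<sigma>)\<^sup>2) = 1 / (4 * \<sigma>\<^sup>2)"
        unfolding t using b assms by simp
      moreover have "b ^ 6 / (3 * (sqrt 2 * b ^ 3 * \<sigma>) ^ 3) = (1 / b) ^ 3 / (6 * sqrt 2 * \<sigma> ^ 3)"
        unfolding t using b assms by (simp add: field_simps eval_nat_numeral)
      ultimately show ?thesis by simp
    qed
    have pre: "2 * b ^ 4 * (b\<^sup>2 / (sqrt 2 * b ^ 3 * \<sigma>)\<^sup>2) = 1 / \<sigma>\<^sup>2"
      unfolding t using b assms by (simp add: field_simps eval_nat_numeral)
    show ?thesis
      unfolding \<zeta> P_we_def T0 T1 T2 T3 ex L_def pre[symmetric] by (simp only: mult.assoc)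
  qed

  \<comment> \<open>This is \<open>L\<close> with 0 put for \<open>s\<close>, \<open>v\<close> and
    \<open>1 / b\<close>. What survives is the square of \<open>w\<close> and the integral
    \<open>N\<close> from \<open>T0\<close>, and \<open>N\<close> from \<open>T1\<close>.\<close>
  have "(L \<longlongrightarrow> 1 / \<sigma>\<^sup>2 * (- 0 * 0\<^sup>2 + (\<phi> q0)\<^sup>2 / 2 - 0 * 0\<^sup>2 / 2 - q0 * integral {q0..} (\<lambda>q. (\<phi> q)\<^sup>2)
      + (- q0 * 0 * 0\<^sup>2 + (\<phi> q0)\<^sup>2 * 0 ^ 3 / 2 + integral {q0..} (\<lambda>q. (\<phi> q)\<^sup>2)) / (sqrt 2 * \<sigma>)
      + (0 * 0\<^sup>2 + integral {q0..} (\<lambda>q. (\<phi> q)\<^sup>2) * 0 ^ 3) / (2 * \<sigma>\<^sup>2)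
      + 0 * 0 ^ 5 / (2 * sqrt 2 * \<sigma> ^ 3))
      * exp (\<delta> / \<sigma> - 1 / (4 * \<sigma>\<^sup>2) - 0 ^ 3 / (6 * sqrt 2 * \<sigma> ^ 3))) at_top" (is "(L \<longlongrightarrow> ?l) _")
    unfolding L_def using assms by (intro tendsto_intros s v w n r) auto
  also have "?l = 1 / (4 * pi * \<sigma>\<^sup>2) * exp (\<delta> / \<sigma> - 1 / (4 * \<sigma>\<^sup>2))
            * (exp (- 2 * \<delta>\<^sup>2) + (1 / \<sigma> - 2 * \<delta>) * integral {2 * \<delta>..} (\<lambda>p. exp (- p\<^sup>2 / 2)))"
  proof -
    have 1: "(\<phi> q0)\<^sup>2 = exp (- 2 * \<delta>\<^sup>2) / (2 * pi)"
      by (simp add: \<phi>_def q0_def power_divide power_mult_distrib flip: exp_double)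
    \<comment> \<open>Stretching by \<open>sqrt 2\<close> turns the squared Gaussian into the one in
      the claim and moves the endpoint \<open>sqrt 2 * \<delta>\<close> to
      \<open>2 * \<delta>\<close>.\<close>
    have 2: "integral {q0..} (\<lambda>q. (\<phi> q)\<^sup>2) = integral {2 * \<delta>..} (\<lambda>p. exp (- p\<^sup>2 / 2)) / (2 * pi * sqrt 2)"
      unfolding \<phi>_def integral_gaussian_square by (simp add: q0_def flip: mult.assoc)
    show ?thesis
      unfolding 1 2 using assms by (simp add: q0_def field_simps)
  qed
  finally have "(L \<longlongrightarrow> 1 / (4 * pi * \<sigma>\<^sup>2) * exp (\<delta> / \<sigma> - 1 / (4 * \<sigma>\<^sup>2))
            * (exp (- 2 * \<delta>\<^sup>2) + (1 / \<sigma> - 2 * \<delta>) * integral {2 * \<delta>..} (\<lambda>p. exp (- p\<^sup>2 / 2)))) at_top" .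
  moreover have "\<forall>\<^sub>F b in at_top. L b = 2 * b ^ 4 * P_we b (sqrt 2 * b * \<delta>) (sqrt 2 * b ^ 3 * \<sigma>)"
    using eventually_ge_at_top[of 1] by eventually_elim (simp only: eq)
  ultimately show ?thesis by (rule Lim_transform_eventually)
qed

end
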